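(* Let $(X,\mathcal{B})$ be a primitive uniform space, and let $F\colon X\to 2^{X}$ be a mapping such that, for every $x\in X$, the set $c_{\mathcal{B}}(F(x))$ is a singleton and $c_{\mathcal{B}}(F(x))\subset F(x)$. Let $f=c_{\mathcal{B}}\circ F\colon X\to X$, i.e. $f(z)$ is the unique element of $c_{\mathcal{B}}(F(z))$ for each $z\in X$. Assume that $\emptyset\neq Y\subset X$ is such that $f(Y)\subset Y$ (e.g. this holds if $F(Y)\subset Y$), and that $x\in c_{\mathcal{B}}(f_{\mid Y})$. If $$f(Y\cap B(x))\subset B(f(x))\quad\text{for all } B\in\mathcal{B},$$ then $f(x)\in c_{\mathcal{B}}(f_{\mid Y})$, and $x$ is a fixed point of $F$ (i.e. $x\in F(x)$) provided that $c_{\mathcal{B}}(f_{\mid Y})$ is a singleton.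
   Context: A primitive uniform space is a pair $(X,\mathcal{B})$, where $X$ is a nonempty set and $\mathcal{B}$ is a family of subsets of $X\times X$ such that $X\times X\in\mathcal{B}$ (no other condition is imposed on $\mathcal{B}$). For $B\in\mathcal{B}$ and $x\in X$ write $B(x)=\{y\in X:(x,y)\in B\}$. A (multivalued) mapping $F\colon Y\to 2^{Y}$ assigns to each $y\in Y$ a nonempty subset $F(y)\subset Y$ (likewise for $F\colon X\to 2^{X}$); $F(A)=\bigcup_{a\in A}F(a)$ and $F^{n}(Y)$ denotes the $n$-th iterated image of $Y$ under $F$, $n\in\mathbb{N}$. A single-valued mapping $f$ is identified with $y\mapsto\{f(y)\}$. Centre of a set: for a nonempty $A\subset X$, a point $x\in X$ is a central point for $A$ if $$\bigcap\{B\in\mathcal{B}: A\subset B(z)\text{ for some } z\in X\}=\bigcap\{B\in\mathcal{B}: A\subset B(x)\};$$ the centre $c_{\mathcal{B}}(A)$ is the set of all central points for $A$. Centre of a mapping: let $\emptyset\neq Y\subset X$ and let $G\colon Y\to 2^{Y}$ be a mapping. A point $x\in X$ is a central point for $G$ if $$\bigcap\{B\in\mathcal{B}: G^{n}(Y)\subset B(z)\text{ for some } n\in\mathbb{N}\text{ and some } z\in X\}=\bigcap\{B\in\mathcal{B}: G^{n}(Y)\subset B(x)\text{ for some } n\in\mathbb{N}\}.$$ The centre $c_{\mathcal{B}}(G)$ of $G$ is the set of all central points for $G$. Here $f_{\mid Y}$ is the restriction of $f$ to $Y$, regarded as a mapping of $Y$ into $Y$. *)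

theory Defs
  imports Main
begin

definition primitive_uniform_space :: "'a set \<Rightarrow> ('a \<times> 'a) set set \<Rightarrow> bool" where
  "primitive_uniform_space X \<B> \<longleftrightarrow> X \<noteq> {} \<and> \<B> \<subseteq> Pow (X \<times> X) \<and> X \<times> X \<in> \<B>"

definition multivalued_map_on :: "'a set \<Rightarrow> ('a \<Rightarrow> 'a set) \<Rightarrow> bool" where
  "multivalued_map_on Y F \<longleftrightarrow> (\<forall>y\<in>Y. F y \<noteq> {} \<and> F y \<subseteq> Y)"

definition multi_image :: "('a \<Rightarrow> 'a set) \<Rightarrow> 'a set \<Rightarrow> 'a set" where
  "multi_image F A = (\<Union>a\<in>A. F a)"

text \<open>
  For \<open>B \<subseteq> X \<times> X\<close> and \<open>x \<in> X\<close>, the set \<open>B(x) = {y \<in> X. (x, y) \<in> B}\<close> is the relational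
  image \<open>B `` {x}\<close>. If \<open>A \<subseteq> X\<close>, the relation \<open>X \<times> X\<close> belongs to each of the
  families below, so no intersection is taken over an empty family.
\<close>

definition set_centre :: "'a set \<Rightarrow> ('a \<times> 'a) set set \<Rightarrow> 'a set \<Rightarrow> 'a set" where
  "set_centre X \<B> A =
    {x\<in>X. \<Inter>{B\<in>\<B>. \<exists>z\<in>X. A \<subseteq> B `` {z}} = \<Inter>{B\<in>\<B>. A \<subseteq> B `` {x}}}"

text \<open>
  The mapping \<open>G\<close> is understood to satisfy \<^term>\<open>multivalued_map_on Y G\<close>; its values outside \<open>Y\<close>
  are irrelevant, so restriction to \<open>Y\<close> needs no separate operation. The iterates
  start at \<open>n = 0\<close>; starting at \<open>n = 1\<close> yields the same centre, see \<open>map_centre_from_1\<close>.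
\<close>

definition map_centre ::
    "'a set \<Rightarrow> ('a \<times> 'a) set set \<Rightarrow> 'a set \<Rightarrow> ('a \<Rightarrow> 'a set) \<Rightarrow> 'a set" where
  "map_centre X \<B> Y G =
    {x\<in>X. \<Inter>{B\<in>\<B>. \<exists>n. \<exists>z\<in>X. (multi_image G ^^ n) Y \<subseteq> B `` {z}}
         = \<Inter>{B\<in>\<B>. \<exists>n. (multi_image G ^^ n) Y \<subseteq> B `` {x}}}"

lemma multi_image_funpow_Suc_subset:
  assumes "multivalued_map_on Y G"
  shows "(multi_image G ^^ Suc n) Y \<subseteq> (multi_image G ^^ n) Y"
proof (induction n)
  case 0
  then show ?case
    using assms by (auto simp: multivalued_map_on_def multi_image_def)
next
  case (Suc n)
  have "multi_image G ((multi_image G ^^ Suc n) Y) \<subseteq> multi_image G ((multi_image G ^^ n) Y)"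
    using Suc unfolding multi_image_def by blast
  then show ?case by simp
qed

lemma map_centre_from_1:
  assumes "multivalued_map_on Y G"
  shows "map_centre X \<B> Y G =
    {x\<in>X. \<Inter>{B\<in>\<B>. \<exists>n\<ge>1. \<exists>z\<in>X. (multi_image G ^^ n) Y \<subseteq> B `` {z}}
         = \<Inter>{B\<in>\<B>. \<exists>n\<ge>1. (multi_image G ^^ n) Y \<subseteq> B `` {x}}}"
proof -
  have "(\<exists>n. (multi_image G ^^ n) Y \<subseteq> S) \<longleftrightarrow> (\<exists>n\<ge>1. (multi_image G ^^ n) Y \<subseteq> S)" for S
  proof
    assume "\<exists>n. (multi_image G ^^ n) Y \<subseteq> S"
    then obtain n where "(multi_image G ^^ n) Y \<subseteq> S" by blast
    with multi_image_funpow_Suc_subset[OF assms, of n]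
    have "(multi_image G ^^ Suc n) Y \<subseteq> S" by (rule subset_trans)
    then show "\<exists>n\<ge>1. (multi_image G ^^ n) Y \<subseteq> S"
      by (intro exI[of _ "Suc n"]) simp
  qed blast
  then have "(\<exists>n. (multi_image G ^^ n) Y \<subseteq> B `` {x}) \<longleftrightarrow>
        (\<exists>n\<ge>1. (multi_image G ^^ n) Y \<subseteq> B `` {x})"
    and "(\<exists>n. \<exists>z\<in>X. (multi_image G ^^ n) Y \<subseteq> B `` {z}) \<longleftrightarrow>
        (\<exists>n\<ge>1. \<exists>z\<in>X. (multi_image G ^^ n) Y \<subseteq> B `` {z})" for B x
    by blast+
  then show ?thesis
    by (simp only: map_centre_def)
qed

lemma centre_selection_image_subset:
  assumes "\<forall>z\<in>X. is_singleton (set_centre X \<B> (F z)) \<and> set_centre X \<B> (F z) \<subseteq> F z"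
    and "\<forall>z\<in>X. f z = the_elem (set_centre X \<B> (F z))"
    and "Y \<subseteq> X" and "multi_image F Y \<subseteq> Y"
  shows "f ` Y \<subseteq> Y"
proof
  fix w assume "w \<in> f ` Y"
  then obtain y where y: "y \<in> Y" "w = f y" by blast
  with assms(1-3) have "w \<in> F y"
    by (auto elim!: is_singletonE dest!: bspec[where x = y])
  with y assms(4) show "w \<in> Y"
    by (auto simp: multi_image_def)
qed

end

theory Submission
  imports Defs
begin

text \<open>
  For \<open>p \<in> X\<close> let \<open>\<B>(p)\<close> be the family of those \<open>B \<in> \<B>\<close> whose section \<open>B(p)\<close> absorbs some
  iterated image \<open>f\<^sup>n(Y)\<close>. The point \<open>p\<close> is central for \<open>f\<close> restricted to \<open>Y\<close> if and only if
  \<open>\<Inter>\<B>(p)\<close> is equal to the intersection of the union of all these families; since \<open>\<B>(p)\<close> is always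
  part of that union, centrality says that \<open>\<Inter>\<B>(p)\<close> is as small as possible. Hence centrality passes
  from \<open>x\<close> to every point \<open>y \<in> X\<close> with \<open>\<B>(x) \<subseteq> \<B>(y)\<close> (lemma \<open>map_centre_mono\<close>).

  The hypothesis \<open>f(Y \<inter> B(x)) \<subseteq> B(f(x))\<close> gives this inclusion for \<open>y = f(x)\<close>: if
  \<open>f\<^sup>n(Y) \<subseteq> B(x)\<close>, then one more application of \<open>f\<close> yields \<open>f\<^sup>n\<^sup>+\<^sup>1(Y) \<subseteq> B(f(x))\<close>. So \<open>f\<close> maps the
  central point \<open>x\<close> to a central point. If there is only one central point, then \<open>f(x) = x\<close>, and \<open>x\<close>
  is a fixed point of \<open>F\<close> because \<open>f\<close> selects from \<open>F\<close>.
\<close>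

text \<open>
  Enlarging the family of relations that absorb an iterate at the point can only shrink its
  intersection, and at a central point this intersection is already minimal.
\<close>

lemma map_centre_mono:
  assumes central: "x \<in> map_centre X \<B> Y G"
    and "y \<in> X"
    and absorb: "\<And>B n. B \<in> \<B> \<Longrightarrow> (multi_image G ^^ n) Y \<subseteq> B `` {x} \<Longrightarrow>
      \<exists>m. (multi_image G ^^ m) Y \<subseteq> B `` {y}"
  shows "y \<in> map_centre X \<B> Y G"
proof -
  let ?at = "\<lambda>p. {B\<in>\<B>. \<exists>n. (multi_image G ^^ n) Y \<subseteq> B `` {p}}"
  let ?all = "{B\<in>\<B>. \<exists>n. \<exists>z\<in>X. (multi_image G ^^ n) Y \<subseteq> B `` {z}}"
  have all: "\<Inter>?all = \<Inter>(?at x)"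
    using central unfolding map_centre_def by (elim CollectE conjE)
  have "\<Inter>?all \<subseteq> \<Inter>(?at y)"
    by (rule Inter_anti_mono) (use \<open>y \<in> X\<close> in blast)
  moreover have "\<Inter>(?at y) \<subseteq> \<Inter>?all"
    unfolding all by (rule Inter_anti_mono) (use absorb in blast)
  ultimately have "\<Inter>?all = \<Inter>(?at y)"
    by (rule subset_antisym)
  with \<open>y \<in> X\<close> show ?thesis
    unfolding map_centre_def by (intro CollectI conjI)
qed

lemma multi_image_singleton: "multi_image (\<lambda>y. {f y}) A = f ` A"
  by (auto simp: multi_image_def)

lemma funpow_multi_image_singleton_subset:
  assumes "f ` Y \<subseteq> Y"
  shows "(multi_image (\<lambda>y. {f y}) ^^ n) Y \<subseteq> Y"
  by (induction n) (use assms in \<open>auto simp: multi_image_singleton\<close>)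

text \<open>
  The hypothesis on \<open>f\<close> controls only points of \<open>Y\<close>; invariance of \<open>Y\<close> keeps all iterated images
  inside \<open>Y\<close>, so that it applies to them.
\<close>

lemma map_centre_image:
  assumes "f ` Y \<subseteq> Y"
    and "x \<in> map_centre X \<B> Y (\<lambda>y. {f y})"
    and "f x \<in> X"
    and step: "\<And>B. B \<in> \<B> \<Longrightarrow> f ` (Y \<inter> B `` {x}) \<subseteq> B `` {f x}"
  shows "f x \<in> map_centre X \<B> Y (\<lambda>y. {f y})"
proof (rule map_centre_mono[OF assms(2,3)])
  fix B n
  let ?I = "\<lambda>n. (multi_image (\<lambda>y. {f y}) ^^ n) Y"
  assume "B \<in> \<B>" and "?I n \<subseteq> B `` {x}"
  with funpow_multi_image_singleton_subset[OF assms(1), of n]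
  have "f ` ?I n \<subseteq> f ` (Y \<inter> B `` {x})"
    by blast
  also have "\<dots> \<subseteq> B `` {f x}"
    using step \<open>B \<in> \<B>\<close> .
  finally have "?I (Suc n) \<subseteq> B `` {f x}"
    by (simp add: multi_image_singleton)
  then show "\<exists>m. ?I m \<subseteq> B `` {f x}" ..
qed

theorem theorem7:
  fixes X Y :: "'a set" and \<B> :: "('a \<times> 'a) set set"
    and F :: "'a \<Rightarrow> 'a set" and f :: "'a \<Rightarrow> 'a" and x :: 'a
  assumes "primitive_uniform_space X \<B>"
    and "multivalued_map_on X F"
    and "\<forall>z\<in>X. is_singleton (set_centre X \<B> (F z)) \<and> set_centre X \<B> (F z) \<subseteq> F z"
    and "\<forall>z\<in>X. f z = the_elem (set_centre X \<B> (F z))"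
    and "Y \<noteq> {}" and "Y \<subseteq> X" and "f ` Y \<subseteq> Y"
    and "x \<in> map_centre X \<B> Y (\<lambda>y. {f y})"
    and "\<forall>B\<in>\<B>. f ` (Y \<inter> B `` {x}) \<subseteq> B `` {f x}"
  shows "f x \<in> map_centre X \<B> Y (\<lambda>y. {f y}) \<and>
    (is_singleton (map_centre X \<B> Y (\<lambda>y. {f y})) \<longrightarrow> x \<in> F x)"
proof -
  have "x \<in> X"
    using assms(8) by (simp add: map_centre_def)
  then have "is_singleton (set_centre X \<B> (F x))" and sub: "set_centre X \<B> (F x) \<subseteq> F x"
    and "f x = the_elem (set_centre X \<B> (F x))"
    using assms(3,4) by blast+
  then have sel: "f x \<in> set_centre X \<B> (F x)"
    by (metis is_singleton_the_elem singletonI)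
  then have "f x \<in> X"
    by (simp add: set_centre_def)
  have "f x \<in> F x"
    using sel sub by blast
  have centre: "f x \<in> map_centre X \<B> Y (\<lambda>y. {f y})"
    using map_centre_image[OF assms(7,8) \<open>f x \<in> X\<close>] assms(9) by blast
  moreover have "x \<in> F x" if "is_singleton (map_centre X \<B> Y (\<lambda>y. {f y}))"
  proof -
    have "f x = x"
      using that centre assms(8) by (metis is_singletonE singletonD)
    with \<open>f x \<in> F x\<close> show ?thesis
      by simp
  qed
  ultimately show ?thesis
    by blast
qed

end
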